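(* For $n\ge1$ let $g_n(x)=\sum_{v\in V(\mathcal{R}_n)}x^{\deg(v)}$ be the degree enumerator polynomial of the Fibonacci-run graph $\mathcal{R}_n$. Then $$f(t,x)=\sum_{n\ge1}g_n(x)t^n=\frac{N_x}{D_x},$$ where $$\begin{aligned}N_x={}&xt\Big(2-(x-2)t+(x-3)t^2-(x-2)^2t^3-x(x-1)t^4-2(x-1)t^5\\&-(x-1)(2x^2-x+1)t^6-2x(x-1)^2t^7-x(x-1)^2(x+1)t^8\\&-x(x-1)^3t^9-x(x-1)^3t^{10}\Big)\end{aligned}$$ and $$D_x=1-xt-2t^2+xt^3+t^4-x(x-1)t^5+x(x-1)(x+1)t^7+2x^2(x-1)^2t^9+x^2(x-1)^3t^{11}.$$
   Context: A binary string is run-constrained if every run of 1s in it is immediately followed by a run of 0s of strictly greater length (the empty string counts as run-constrained). For $n\ge1$ the Fibonacci-run graph $\mathcal{R}_n$ has vertex set $\{w\in\{0,1\}^n : w00 \text{ is run-constrained}\}$, two vertices being adjacent iff they differ in exactly one coordinate; $\deg(v)$ is the degree of $v$ in $\mathcal{R}_n$. The identity is one of formal power series in $t$. *)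

theory Defs
  imports
    "HOL-Computational_Algebra.Polynomial"
    "HOL-Computational_Algebra.Formal_Power_Series"
begin

text \<open>
  Binary strings are lists of booleans, with \<open>True\<close> for 1 and \<open>False\<close> for 0. The conditions on
  \<open>u\<close> and \<open>v\<close> say that the block of \<open>k\<close> ones is a run (a maximal block); the run of zeros
  immediately following it is the longest prefix of zeros of \<open>v\<close>.
\<close>

definition run_constrained :: "bool list \<Rightarrow> bool" where
  "run_constrained w \<longleftrightarrow>
    (\<forall>u k v. w = u @ replicate k True @ v \<and> k \<ge> 1 \<and>
        (u = [] \<or> last u = False) \<and> (v = [] \<or> hd v = False) \<longrightarrow>
      length (takeWhile (\<lambda>b. b = False) v) > k)"

definition fib_run_verts :: "nat \<Rightarrow> bool list set" where
  "fib_run_verts n = {w. length w = n \<and> run_constrained (w @ [False, False])}"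

definition fib_run_adj :: "nat \<Rightarrow> bool list \<Rightarrow> bool list \<Rightarrow> bool" where
  "fib_run_adj n v w \<longleftrightarrow>
    v \<in> fib_run_verts n \<and> w \<in> fib_run_verts n \<and> card {i. i < n \<and> v ! i \<noteq> w ! i} = 1"

definition fib_run_deg :: "nat \<Rightarrow> bool list \<Rightarrow> nat" where
  "fib_run_deg n v = card {w. fib_run_adj n v w}"

definition fib_run_deg_enum :: "nat \<Rightarrow> int poly" where
  "fib_run_deg_enum n = (\<Sum>v\<in>fib_run_verts n. monom 1 (fib_run_deg n v))"

text \<open>A power series in \<open>t\<close> with coefficients in \<open>\<int>[x]\<close>; the sum starts at \<open>n = 1\<close>.\<close>

definition fib_run_deg_gf :: "int poly fps" where
  "fib_run_deg_gf = Abs_fps (\<lambda>n. if n \<ge> 1 then fib_run_deg_enum n else 0)"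

end

theory Submission
  imports Defs
begin

text \<open>
  The run-constrained words form the free monoid on the letter \<open>0\<close> and the blocks
  \<open>B\<^sub>k = 1\<^sup>k 0\<^sup>k\<^sup>+\<^sup>1\<close> with \<open>k \<ge> 1\<close>. All of them that have length at least 2 end
  in \<open>00\<close>, so the vertices of \<open>R\<^sub>n\<close> are exactly the run-constrained words of length \<open>n + 2\<close> and
  the degree of a vertex counts the single-letter flips that keep such a word run-constrained.
  Removing the first factor changes this count locally: \<open>0s\<close> has one more flip than \<open>s\<close> iff \<open>1s\<close>
  is run-constrained, and \<open>B\<^sub>k r\<close> has, compared to \<open>r\<close>, one more flip if \<open>k = 1\<close> and two if
  \<open>k \<ge> 2\<close> (the ends of the run of ones), plus one if \<open>r\<close> starts with \<open>00\<close>. Classifying words by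
  their first factors therefore gives a linear system for five generating functions, which
  is solved explicitly.
\<close>

section \<open>Run-constrained words\<close>

unbundle fps_syntax

definition leading_zeros :: "bool list \<Rightarrow> nat" where
  "leading_zeros v = length (takeWhile Not v)"

lemma leading_zeros_simps [simp]:
  "leading_zeros [] = 0"
  "leading_zeros (False # v) = Suc (leading_zeros v)"
  "leading_zeros (True # v) = 0"
  "leading_zeros (replicate m False @ v) = m + leading_zeros v"
  by (induction m) (auto simp: leading_zeros_def)

text \<open>The curried premises let \<open>rule_format\<close> instantiate the definition directly
  at a chosen split of the word.\<close>

lemma run_constrained_alt:
  "run_constrained w \<longleftrightarrow>
    (\<forall>u k v. w = u @ replicate k True @ v \<longrightarrow> k \<ge> 1 \<longrightarrow>
        (u = [] \<or> \<not> last u) \<longrightarrow> (v = [] \<or> \<not> hd v) \<longrightarrow> k < leading_zeros v)"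
  unfolding run_constrained_def leading_zeros_def imp_conjL by simp

lemma run_constrained_Nil [simp]: "run_constrained []"
  by (auto simp: run_constrained_alt)

lemma run_constrained_False [simp]: "run_constrained (False # s) \<longleftrightarrow> run_constrained s"
proof
  assume L: "run_constrained (False # s)"
  show "run_constrained s"
    unfolding run_constrained_alt
  proof (intro allI impI)
    fix u k v
    assume "s = u @ replicate k True @ v" "1 \<le> k" "u = [] \<or> \<not> last u" "v = [] \<or> \<not> hd v"
    then show "k < leading_zeros v"
      using L[unfolded run_constrained_alt, rule_format, of "False # u" k v] by (cases "u = []") auto
  qed
next
  assume R: "run_constrained s"
  show "run_constrained (False # s)"
    unfolding run_constrained_alt
  proof (intro allI impI)
    fix u k v
    assume *: "False # s = u @ replicate k True @ v" "1 \<le> k" "u = [] \<or> \<not> last u" "v = [] \<or> \<not> hd v"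
    show "k < leading_zeros v"
    proof (cases u)
      case Nil
      then show ?thesis using * by (cases k) auto
    next
      case (Cons a u')
      then show ?thesis
        using * R[unfolded run_constrained_alt, rule_format, of u' k v] by (auto split: if_splits)
    qed
  qed
qed

lemma run_constrained_zeros [simp]:
  "run_constrained (replicate m False @ s) \<longleftrightarrow> run_constrained s"
  by (induction m) auto

lemma leading_ones_unique:
  assumes "replicate k True @ v = replicate j True @ v'"
    and "v = [] \<or> \<not> hd v" "v' = [] \<or> \<not> hd v'"
  shows "k = j \<and> v = v'"
  using assms
proof (induction k arbitrary: j)
  case 0
  then show ?case by (cases j) auto
next
  case (Suc k)
  then show ?case by (cases j) auto
qed

text \<open>As \<open>v\<close> does not start with 1, the \<open>k\<close> ones form a complete
  run, and every other run lies inside \<open>v\<close>. The condition thus splits into one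
  inequality for the first run and the condition on \<open>v\<close>.\<close>

lemma run_constrained_ones_append:
  assumes k: "k \<ge> 1" and v: "v = [] \<or> \<not> hd v"
  shows "run_constrained (replicate k True @ v) \<longleftrightarrow> k < leading_zeros v \<and> run_constrained v"
    (is "?L \<longleftrightarrow> ?R")
proof
  assume L: ?L
  have z: "k < leading_zeros v"
    using L[unfolded run_constrained_alt, rule_format, of "[]" k v] k v by auto
  then obtain v' where v': "v = False # v'"
    using v by (cases v) auto
  \<comment> \<open>With the first zero peeled off \<open>v\<close>, even a run at the very start of
    \<open>v'\<close> is preceded by a zero in the whole word.\<close>
  have "run_constrained v'"
    unfolding run_constrained_alt
  proof (intro allI impI)
    fix u j r
    assume "v' = u @ replicate j True @ r" "1 \<le> j" "u = [] \<or> \<not> last u" "r = [] \<or> \<not> hd r"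
    then show "j < leading_zeros r"
      using L[unfolded run_constrained_alt, rule_format, of "replicate k True @ False # u" j r] v'
      by (cases "u = []") auto
  qed
  then show ?R using z v' by simp
next
  assume R: ?R
  show ?L
    unfolding run_constrained_alt
  proof (intro allI impI)
    fix u j r
    assume eq: "replicate k True @ v = u @ replicate j True @ r"
      and j: "1 \<le> j" and u: "u = [] \<or> \<not> last u" and r: "r = [] \<or> \<not> hd r"
    from eq consider us where "replicate k True = u @ us" "us @ v = replicate j True @ r"
      | us where "u = replicate k True @ us" "v = us @ replicate j True @ r"
      by (auto simp: append_eq_append_conv2)
    then show "j < leading_zeros r"
    proof cases
      case 1
      \<comment> \<open>A nonempty \<open>u\<close> contained in the initial ones would end in
        1.\<close>
      have "u = []"
      proof (rule ccontr)
        assume "u \<noteq> []"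
        then have "last u \<in> set (replicate k True)" using 1(1) by simp
        then show False using u \<open>u \<noteq> []\<close> by simp
      qed
      then have "k = j \<and> v = r" using eq v r leading_ones_unique[of k v j r] by simp
      then show ?thesis using R by auto
    next
      case 2
      have "us \<noteq> []" using 2 v j by (cases j) auto
      then have "us = [] \<or> \<not> last us" using u 2 by auto
      then show ?thesis
        using R[THEN conjunct2, unfolded run_constrained_alt, rule_format, of us j r] 2 j r by auto
    qed
  qed
qed

text \<open>The zeros after the first run continue into \<open>v\<close>, so its run of zeros has
  length \<open>m + leading_zeros v\<close>. Most later validity tests of flipped words reduce to
  this form.\<close>

lemma run_constrained_block:
  assumes "k \<ge> 1" "m \<ge> 1"
  shows "run_constrained (replicate k True @ replicate m False @ v)
    \<longleftrightarrow> k < m + leading_zeros v \<and> run_constrained v"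
  using run_constrained_ones_append[of k "replicate m False @ v"] assms by (cases m) auto

definition block :: "nat \<Rightarrow> bool list \<Rightarrow> bool list" where
  "block k r = replicate k True @ replicate (Suc k) False @ r"

lemma length_block [simp]: "length (block k r) = 2 * k + 1 + length r"
  by (simp add: block_def)

lemma run_constrained_block_iff:
  "k \<ge> 1 \<Longrightarrow> run_constrained (block k r) \<longleftrightarrow> run_constrained r"
  using run_constrained_block[of k "Suc k" r] by (simp add: block_def del: replicate_Suc)

lemma leading_ones_exist: "\<exists>k v. s = replicate k True @ v \<and> (v = [] \<or> \<not> hd v)"
proof (induction s)
  case Nil
  show ?case by (rule exI[of _ 0]) auto
next
  case (Cons a s)
  then obtain k v where kv: "s = replicate k True @ v" "v = [] \<or> \<not> hd v" by auto
  show ?case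
  proof (cases a)
    case True
    then show ?thesis using kv by (intro exI[of _ "Suc k"] exI[of _ v]) auto
  next
    case False
    then show ?thesis by (intro exI[of _ 0] exI[of _ "a # s"]) auto
  qed
qed

lemma leading_zeros_split:
  "m \<le> leading_zeros v \<Longrightarrow> \<exists>r. v = replicate m False @ r"
proof (induction m arbitrary: v)
  case (Suc m)
  then obtain v' where "v = False # v'" by (cases v; cases "hd v") auto
  with Suc show ?case by auto
qed auto

text \<open>First factor in the free monoid: an initial run of \<open>k\<close> ones is followed by
  at least \<open>k + 1\<close> zeros. The first \<open>k + 1\<close> of them complete the block,
  and surplus zeros go to \<open>r\<close>.\<close>

lemma run_constrained_cases:
  assumes "run_constrained s"
  obtains "s = []"
    | s' where "s = False # s'" "run_constrained s'"
    | k r where "k \<ge> 1" "s = block k r" "run_constrained r"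
proof -
  obtain k v where kv: "s = replicate k True @ v" "v = [] \<or> \<not> hd v"
    using leading_ones_exist by blast
  show thesis
  proof (cases "k = 0")
    case True
    then show thesis using that assms kv by (cases v) auto
  next
    case False
    then have "k < leading_zeros v" using kv assms run_constrained_ones_append[of k v] by auto
    then obtain r where "v = replicate (Suc k) False @ r"
      using leading_zeros_split[of "Suc k" v] by auto
    then have "s = block k r" using kv by (simp add: block_def)
    then show thesis using that(3)[of k r] False assms run_constrained_block_iff[of k r] by auto
  qed
qed

text \<open>Strong induction on the length, removing the first factor. Only a remainder of length at
  most 1 needs a direct check.\<close>

lemma run_constrained_suffix:
  assumes "run_constrained s" "length s \<ge> 2"
  shows "\<exists>u. s = u @ [False, False]"
  using assms
proof (induction "length s" arbitrary: s rule: less_induct)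
  case less
  from less.prems(1) show ?case
  proof (cases rule: run_constrained_cases)
    case 1
    then show ?thesis using less by auto
  next
    case (2 s')
    show ?thesis
    proof (cases "length s' \<ge> 2")
      case True
      then obtain u where "s' = u @ [False, False]" using less.hyps[of s'] 2 by auto
      then show ?thesis using 2 by (intro exI[of _ "False # u"]) auto
    next
      case False
      then obtain b where b: "s' = [b]" using 2 less.prems by (cases s'; cases "tl s'") auto
      have "\<not> b" using 2 b run_constrained_ones_append[of 1 "[]"] by (cases b) auto
      then show ?thesis using 2 b by auto
    qed
  next
    case (3 k r)
    then obtain k' where k': "k = Suc k'" by (cases k) auto
    \<comment> \<open>A remainder of length 1 must be 0, because a lone 1 is not
      run-constrained.\<close>
    consider "r = []" | "r = [False]" | "length r \<ge> 2"
    proof (cases r rule: list.exhaust)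
      case (Cons b r')
      then show ?thesis using that 3 run_constrained_ones_append[of 1 "[]"]
        by (cases r'; cases b) auto
    qed (use that in auto)
    then show ?thesis
    proof cases
      case 1
      then show ?thesis
        using 3 k' by (intro exI[of _ "replicate k True @ replicate k' False"])
          (simp add: block_def replicate_app_Cons_same)
    next
      case 2
      then show ?thesis
        using 3 k' by (intro exI[of _ "replicate k True @ replicate k False"])
          (simp add: block_def replicate_app_Cons_same)
    next
      case ge: 3
      then obtain u where "r = u @ [False, False]" using less.hyps[of r] 3 by auto
      then show ?thesis using 3 by (intro exI[of _ "block k u"]) (auto simp: block_def)
    qed
  qed
qed

section \<open>Flips that preserve the run constraint\<close>

definition flip :: "bool list \<Rightarrow> nat \<Rightarrow> bool list" where
  "flip s i = s[i := \<not> s ! i]"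

text \<open>All positions count, including those of the padding \<open>00\<close>;
  \<open>fib_run_deg_eq\<close> shows that the padding contributes nothing.\<close>

definition flip_count :: "bool list \<Rightarrow> nat" where
  "flip_count s = card {i. i < length s \<and> run_constrained (flip s i)}"

lemma length_flip [simp]: "length (flip s i) = length s"
  by (simp add: flip_def)

lemma flip_append:
  "flip (a @ b) i = (if i < length a then flip a i @ b else a @ flip b (i - length a))"
  by (simp add: flip_def list_update_append nth_append)

lemma flip_Cons_0: "flip (b # s) 0 = (\<not> b) # s"
  by (simp add: flip_def)

lemma flip_count_append:
  "flip_count (a @ b) = card {i. i < length a \<and> run_constrained (flip a i @ b)}
     + card {i. i < length b \<and> run_constrained (a @ flip b i)}"
proof -
  let ?A = "{i. i < length a \<and> run_constrained (flip a i @ b)}"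
  let ?B = "{i. i < length b \<and> run_constrained (a @ flip b i)}"
  have "{i. i < length (a @ b) \<and> run_constrained (flip (a @ b) i)}
    = ?A \<union> (\<lambda>i. i + length a) ` ?B"
  proof (intro equalityI subsetI)
    fix i assume i: "i \<in> {i. i < length (a @ b) \<and> run_constrained (flip (a @ b) i)}"
    show "i \<in> ?A \<union> (\<lambda>i. i + length a) ` ?B"
    proof (cases "i < length a")
      case False
      then have "i = (i - length a) + length a" "i - length a \<in> ?B"
        using i by (auto simp: flip_append)
      then show ?thesis by blast
    qed (use i in \<open>auto simp: flip_append\<close>)
  qed (auto simp: flip_append)
  then have "flip_count (a @ b) = card (?A \<union> (\<lambda>i. i + length a) ` ?B)"
    by (simp add: flip_count_def)
  also have "\<dots> = card ?A + card ((\<lambda>i. i + length a) ` ?B)"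
    by (rule card_Un_disjoint) auto
  also have "card ((\<lambda>i. i + length a) ` ?B) = card ?B"
    by (rule card_image) (auto simp: inj_on_def)
  finally show ?thesis .
qed

text \<open>A leading zero does not affect the validity of flips inside \<open>s\<close>; flipping
  it yields \<open>True # s\<close>.\<close>

lemma flip_count_False:
  "flip_count (False # s) = flip_count s + (if run_constrained (True # s) then 1 else 0)"
proof -
  have "{i. i < 1 \<and> run_constrained (flip [False] i @ s)}
      = (if run_constrained (True # s) then {0} else {})"
    by (auto simp: flip_Cons_0)
  then show ?thesis
    using flip_count_append[of "[False]" s] by (simp add: flip_count_def)
qed

lemma flip_replicate:
  "i < n \<Longrightarrow> flip (replicate n b) i = replicate i b @ (\<not> b) # replicate (n - Suc i) b"
  by (rule nth_equalityI) (auto simp: flip_def nth_list_update nth_append nth_Cons split: nat.splits)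

text \<open>Deleting an end of the run of ones is harmless, and the two ends coincide for
  \<open>k = 1\<close>. An interior deletion leaves several ones before a single zero. Flipping the
  first zero gives \<open>k + 1\<close> ones before \<open>k\<close> zeros, so \<open>r\<close> must
  supply two more. Any later flip cuts the zeros down to at most \<open>k\<close>.\<close>

lemma block_flips:
  assumes k: "k \<ge> 1" and r: "run_constrained r"
  shows "{i. i < 2 * k + 1 \<and> run_constrained (flip (replicate k True @ replicate (Suc k) False) i @ r)}
     = {0, k - 1} \<union> (if leading_zeros r \<ge> 2 then {k} else {})" (is "?L = ?R")
proof -
  let ?P = "\<lambda>i. run_constrained (flip (replicate k True @ replicate (Suc k) False) i @ r)"
  have ones: "?P i \<longleftrightarrow> i = 0 \<or> i = k - 1" if i: "i < k" for i
  proof -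
    have eq: "flip (replicate k True @ replicate (Suc k) False) i @ r
        = replicate i True @ replicate 1 False @ replicate (k - Suc i) True @ replicate (Suc k) False @ r"
      using i by (simp add: flip_append flip_replicate)
    have tail: "run_constrained (replicate (k - Suc i) True @ replicate (Suc k) False @ r)"
      using run_constrained_block[of "k - Suc i" "Suc k" r] r
      by (cases "k - Suc i = 0") (auto simp del: replicate_Suc)
    show ?thesis
    proof (cases "i = 0")
      case True
      then show ?thesis using eq tail by simp
    next
      case False
      then have "?P i \<longleftrightarrow> i < 1 + leading_zeros (replicate (k - Suc i) True @ replicate (Suc k) False @ r)"
        unfolding eq using run_constrained_block[of i 1] tail by (simp del: replicate_Suc)
      \<comment> \<open>If ones remain after position \<open>i\<close>, the run of zeros has length
        1, too short for \<open>i \<ge> 1\<close> ones; otherwise the whole zero run of the block is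
        joined to it.\<close>
      also have "\<dots> \<longleftrightarrow> i = k - 1"
      proof (cases "k - Suc i")
        case 0
        then show ?thesis using i by (simp del: replicate_Suc)
      next
        case (Suc l)
        then show ?thesis using i False by auto
      qed
      finally show ?thesis using False by simp
    qed
  qed
  have first: "?P k \<longleftrightarrow> leading_zeros r \<ge> 2"
  proof -
    have "flip (replicate k True @ replicate (Suc k) False) k @ r
        = replicate (Suc k) True @ replicate k False @ r"
      by (simp add: flip_append flip_Cons_0 replicate_app_Cons_same)
    then show ?thesis using run_constrained_block[of "Suc k" k r] k r by (auto simp del: replicate_Suc)
  qed
  have rest: "\<not> ?P i" if i: "k < i" "i < 2 * k + 1" for i
  proof -
    have "flip (replicate k True @ replicate (Suc k) False) i @ r
        = replicate k True @ replicate (i - k) False @ True # replicate (Suc k - Suc (i - k)) False @ r"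
      using i by (simp add: flip_append flip_replicate del: replicate_Suc)
    then show ?thesis using run_constrained_block[of k "i - k"] i k by auto
  qed
  show ?thesis
  proof (intro equalityI subsetI)
    fix i assume "i \<in> ?L"
    then show "i \<in> ?R"
      using ones[of i] first rest[of i] by (cases i k rule: linorder_cases) auto
  next
    fix i assume "i \<in> ?R"
    then show "i \<in> ?L"
      using ones[of i] first k by (auto split: if_splits)
  qed
qed

text \<open>Flips inside \<open>r\<close> are valid after the block exactly when they are valid in
  \<open>r\<close> alone. The bracketing separates the share of \<open>k\<close> from the share of
  \<open>r\<close>, so that the generating function factors.\<close>

lemma flip_count_block:
  assumes k: "k \<ge> 1" and r: "run_constrained r"
  shows "flip_count (block k r)
    = (if k = 1 then 1 else 2) + (flip_count r + (if leading_zeros r \<ge> 2 then 1 else 0))"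
proof -
  have "card ({0, k - 1} \<union> (if leading_zeros r \<ge> 2 then {k} else {}))
      = (if k = 1 then 1 else 2) + (if leading_zeros r \<ge> 2 then 1 else 0)"
    using k by (auto simp: card_insert_if)
  then show ?thesis
    using flip_count_append[of "replicate k True @ replicate (Suc k) False" r]
      block_flips[OF assms] run_constrained_block_iff[OF k]
    by (simp add: flip_count_def block_def mult_2 del: replicate_Suc)
qed

lemma run_constrained_True_False:
  "run_constrained s \<Longrightarrow> run_constrained (True # False # s) \<longleftrightarrow> leading_zeros s \<ge> 1"
  using run_constrained_block[of 1 1 s] by auto

text \<open>The run grows to \<open>k + 1\<close> ones, which the \<open>k + 1\<close> zeros of the
  block equal but do not exceed; \<open>r\<close> must supply one more zero.\<close>

lemma run_constrained_True_block:
  "run_constrained r \<Longrightarrow> run_constrained (True # block k r) \<longleftrightarrow> leading_zeros r \<ge> 1"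
  using run_constrained_block[of "Suc k" "Suc k" r] by (auto simp: block_def)

text \<open>Neighbours of \<open>w\<close> correspond to the valid flips inside
  \<open>w\<close>.\<close>

lemma fib_run_deg_eq:
  assumes "w \<in> fib_run_verts n"
  shows "fib_run_deg n w = flip_count (w @ [False, False])"
proof -
  have len: "length w = n" using assms by (simp add: fib_run_verts_def)
  let ?I = "{i. i < n \<and> run_constrained (flip w i @ [False, False])}"
  have "{v. fib_run_adj n w v} = flip w ` ?I"
  proof (intro equalityI subsetI)
    fix v assume "v \<in> {v. fib_run_adj n w v}"
    then have v: "length v = n" "run_constrained (v @ [False, False])"
      and "card {i. i < n \<and> w ! i \<noteq> v ! i} = 1"
      by (auto simp: fib_run_adj_def fib_run_verts_def)
    then obtain i where i: "{i. i < n \<and> w ! i \<noteq> v ! i} = {i}"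
      by (auto simp: card_1_singleton_iff)
    have "v = flip w i"
    proof (rule nth_equalityI)
      fix j assume j: "j < length v"
      have "w ! j \<noteq> v ! j \<longleftrightarrow> j = i" using i j v by blast
      then show "v ! j = flip w i ! j" using j v len by (auto simp: flip_def nth_list_update)
    qed (use v len in simp)
    moreover have "i < n" using i by auto
    ultimately show "v \<in> flip w ` ?I" using v by auto
  next
    fix v assume "v \<in> flip w ` ?I"
    then obtain i where i: "i < n" "run_constrained (flip w i @ [False, False])" "v = flip w i"
      by auto
    then have "{j. j < n \<and> w ! j \<noteq> v ! j} = {i}"
      using len by (auto simp: flip_def nth_list_update)
    then show "v \<in> {v. fib_run_adj n w v}"
      using i assms len by (auto simp: fib_run_adj_def fib_run_verts_def)
  qed
  moreover have "inj_on (flip w) ?I"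
  proof (rule inj_onI)
    fix i j assume *: "i \<in> ?I" "j \<in> ?I" "flip w i = flip w j"
    then have "flip w i ! i = flip w j ! i" by simp
    moreover have "flip w i ! i \<noteq> w ! i" using *(1) len by (simp add: flip_def)
    ultimately have "flip w j ! i \<noteq> w ! i" by simp
    then show "i = j" by (cases "i = j") (simp_all add: flip_def)
  qed
  ultimately have deg: "fib_run_deg n w = card ?I"
    by (simp add: fib_run_deg_def card_image)
  \<comment> \<open>A flip in the padding destroys the ending \<open>00\<close> that every
    run-constrained word of length at least 2 has.\<close>
  have "\<not> run_constrained (w @ flip [False, False] i)" if "i < 2" for i
  proof
    assume "run_constrained (w @ flip [False, False] i)"
    then obtain u where "w @ flip [False, False] i = u @ [False, False]"
      using run_constrained_suffix[of "w @ flip [False, False] i"] by auto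
    then have "flip [False, False] i = [False, False]" by simp
    then show False using that by (auto simp: flip_def less_2_cases_iff)
  qed
  then have "{i. i < 2 \<and> run_constrained (w @ flip [False, False] i)} = {}" by blast
  then show ?thesis
    using flip_count_append[of w "[False, False]"] deg len by (simp add: numeral_2_eq_2)
qed


section \<open>Weighted generating functions\<close>

text \<open>The sum of x^(wt s) t^(len s) over \<open>S\<close>. The carrier type is arbitrary so
  that block indices and pairs are covered as well as words.\<close>

definition weight_gf :: "('a \<Rightarrow> nat) \<Rightarrow> ('a \<Rightarrow> nat) \<Rightarrow> 'a set \<Rightarrow> int poly fps" where
  "weight_gf len wt S = Abs_fps (\<lambda>n. \<Sum>s | s \<in> S \<and> len s = n. monom 1 (wt s))"

text \<open>Excludes infinite fibres, on which \<open>sum\<close> would take its default value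
  0.\<close>

definition finite_fibres :: "('a \<Rightarrow> nat) \<Rightarrow> 'a set \<Rightarrow> bool" where
  "finite_fibres len S \<longleftrightarrow> (\<forall>n. finite {s. s \<in> S \<and> len s = n})"

lemma weight_gf_nth:
  "weight_gf len wt S $ n = (\<Sum>s | s \<in> S \<and> len s = n. monom 1 (wt s))"
  by (simp add: weight_gf_def)

lemma weight_gf_Un:
  assumes "finite_fibres len (A \<union> B)" "A \<inter> B = {}"
  shows "weight_gf len wt (A \<union> B) = weight_gf len wt A + weight_gf len wt B"
proof (rule fps_ext)
  fix n
  have "{s. s \<in> A \<union> B \<and> len s = n} = {s. s \<in> A \<and> len s = n} \<union> {s. s \<in> B \<and> len s = n}" by auto
  moreover from this have "finite ({s. s \<in> A \<and> len s = n} \<union> {s. s \<in> B \<and> len s = n})"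
    using assms(1) unfolding finite_fibres_def by metis
  ultimately show "weight_gf len wt (A \<union> B) $ n = (weight_gf len wt A + weight_gf len wt B) $ n"
    using assms(2) by (simp only: weight_gf_nth fps_add_nth finite_Un) (rule sum.union_disjoint, auto)
qed

lemma weight_gf_image:
  assumes "inj_on h S"
  shows "weight_gf len wt (h ` S) = weight_gf (\<lambda>s. len (h s)) (\<lambda>s. wt (h s)) S"
proof (rule fps_ext)
  fix n
  have "{s. s \<in> h ` S \<and> len s = n} = h ` {s. s \<in> S \<and> len (h s) = n}" by auto
  moreover have "inj_on h {s. s \<in> S \<and> len (h s) = n}"
    using assms by (rule inj_on_subset) auto
  ultimately show "weight_gf len wt (h ` S) $ n = weight_gf (\<lambda>s. len (h s)) (\<lambda>s. wt (h s)) S $ n"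
    by (simp add: weight_gf_nth sum.reindex)
qed

lemma weight_gf_cong:
  assumes "\<And>s. s \<in> S \<Longrightarrow> len s = len' s" "\<And>s. s \<in> S \<Longrightarrow> wt s = wt' s"
  shows "weight_gf len wt S = weight_gf len' wt' S"
proof (rule fps_ext)
  fix n
  show "weight_gf len wt S $ n = weight_gf len' wt' S $ n"
    unfolding weight_gf_nth using assms by (intro sum.cong) auto
qed

text \<open>Sorting the pairs of total length \<open>n\<close> by the length \<open>a\<close> of the
  first component gives the Cauchy product.\<close>

lemma weight_gf_Times:
  assumes I: "finite_fibres l I" and J: "finite_fibres m J"
  shows "weight_gf (\<lambda>(i, j). l i + m j) (\<lambda>(i, j). v i + w j) (I \<times> J)
    = weight_gf l v I * weight_gf m w J"
proof (rule fps_ext)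
  fix n
  let ?f = "\<lambda>(i, j). monom (1 :: int) (v i + w j)"
  let ?C = "\<lambda>a. {i. i \<in> I \<and> l i = a} \<times> {j. j \<in> J \<and> m j = n - a}"
  have "{p. p \<in> I \<times> J \<and> (case p of (i, j) \<Rightarrow> l i + m j) = n} = (\<Union>a\<in>{0..n}. ?C a)"
    by auto
  then have "weight_gf (\<lambda>(i, j). l i + m j) (\<lambda>(i, j). v i + w j) (I \<times> J) $ n
      = sum ?f (\<Union>a\<in>{0..n}. ?C a)"
    by (simp only: weight_gf_nth) (rule sum.cong, auto)
  also have "\<dots> = (\<Sum>a=0..n. sum ?f (?C a))"
    using I J by (intro sum.UNION_disjoint) (auto simp: finite_fibres_def)
  also have "\<dots> = (\<Sum>a=0..n. weight_gf l v I $ a * weight_gf m w J $ (n - a))"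
    by (simp add: weight_gf_nth sum_product sum.cartesian_product mult_monom)
  finally show "weight_gf (\<lambda>(i, j). l i + m j) (\<lambda>(i, j). v i + w j) (I \<times> J) $ n
      = (weight_gf l v I * weight_gf m w J) $ n"
    by (simp add: fps_mult_nth)
qed

lemma weight_gf_singleton:
  "weight_gf len wt {a} = fps_const (monom 1 (wt a)) * fps_X ^ len a"
proof (rule fps_ext)
  fix n
  have "{s. s \<in> {a} \<and> len s = n} = (if len a = n then {a} else {})" by auto
  then show "weight_gf len wt {a} $ n = (fps_const (monom 1 (wt a)) * fps_X ^ len a) $ n"
    by (simp only: weight_gf_nth) (auto simp: fps_X_power_iff)
qed

lemma weight_gf_length_add:
  "weight_gf (\<lambda>s. len s + c) wt S = fps_X ^ c * weight_gf len wt S"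
proof (rule fps_ext)
  fix n
  show "weight_gf (\<lambda>s. len s + c) wt S $ n = (fps_X ^ c * weight_gf len wt S) $ n"
  proof (cases "n < c")
    case False
    then have "{s. s \<in> S \<and> len s + c = n} = {s. s \<in> S \<and> len s = n - c}" by auto
    then show ?thesis using False by (simp add: weight_gf_nth fps_X_power_mult_nth)
  next
    case True
    then have "{s. s \<in> S \<and> len s + c = n} = {}" by auto
    then show ?thesis using True by (simp only: weight_gf_nth) (simp add: fps_X_power_mult_nth)
  qed
qed

text \<open>Pointwise, x^(w+1) = x^w + (x - 1) x^w, so a bonus flip on \<open>P\<close> adds
  \<open>x - 1\<close> times the series of the elements satisfying \<open>P\<close>.\<close>

lemma weight_gf_bonus:
  assumes "finite_fibres len S"
  shows "weight_gf len (\<lambda>s. wt s + (if P s then 1 else 0)) S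
    = weight_gf len wt S + (fps_const (monom 1 1) - 1) * weight_gf len wt {s \<in> S. P s}"
proof (rule fps_ext)
  fix n
  let ?A = "{s. s \<in> S \<and> len s = n}"
  have fin: "finite ?A" using assms by (simp add: finite_fibres_def)
  have "(\<Sum>s\<in>?A. monom 1 (wt s + (if P s then 1 else 0)))
      = (\<Sum>s\<in>?A. monom 1 (wt s) + (if P s then (monom 1 1 - 1) * monom 1 (wt s) else (0 :: int poly)))"
    by (rule sum.cong) (auto simp: algebra_simps mult_monom)
  also have "\<dots> = (\<Sum>s\<in>?A. monom 1 (wt s)) + (monom 1 1 - 1) * (\<Sum>s | s \<in> ?A \<and> P s. monom 1 (wt s))"
    unfolding sum.distrib sum_distrib_left by (simp only: sum.inter_filter[OF fin])
  also have "{s. s \<in> ?A \<and> P s} = {s. s \<in> {s \<in> S. P s} \<and> len s = n}" by auto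
  finally have "weight_gf len (\<lambda>s. wt s + (if P s then 1 else 0)) S $ n
      = weight_gf len wt S $ n + (monom 1 1 - 1) * weight_gf len wt {s \<in> S. P s} $ n"
    by (simp only: weight_gf_nth)
  moreover have "fps_const (monom 1 1) - 1 = fps_const (monom 1 1 - 1 :: int poly)"
    by (simp flip: fps_const_sub)
  ultimately show "weight_gf len (\<lambda>s. wt s + (if P s then 1 else 0)) S $ n
    = (weight_gf len wt S + (fps_const (monom 1 1) - 1) * weight_gf len wt {s \<in> S. P s}) $ n"
    by simp
qed

section \<open>Generating functions of run-constrained words\<close>

definition run_words :: "bool list set" where
  "run_words = {s. run_constrained s}"

abbreviation zero_words :: "bool list set \<Rightarrow> bool list set" where
  "zero_words S \<equiv> Cons False ` S"

abbreviation block_words :: "bool list set \<Rightarrow> bool list set" where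
  "block_words S \<equiv> (\<lambda>(k, r). block k r) ` ({1..} \<times> S)"

abbreviation word_gf :: "bool list set \<Rightarrow> int poly fps" where
  "word_gf \<equiv> weight_gf length flip_count"

text \<open>The series x t^3 + x^2 (t^5 + t^7 + ...), recording for each block its length and the
  flips at the ends of its ones.\<close>

definition block_gf :: "int poly fps" where
  "block_gf = weight_gf (\<lambda>k. 2 * k + 1) (\<lambda>k. if k = 1 then 1 else 2) {1..}"

lemma finite_fibres_length [simp]: "finite_fibres length (S :: bool list set)"
proof -
  have "finite {s. s \<in> S \<and> length s = n}" for n
    by (rule finite_subset[OF _ finite_lists_length_eq[of UNIV n]]) auto
  then show ?thesis by (simp add: finite_fibres_def)
qed

lemma finite_fibres_block [simp]: "finite_fibres (\<lambda>k. 2 * k + 1) S"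
proof -
  have "finite {k. k \<in> S \<and> 2 * k + 1 = n}" for n
    by (rule finite_subset[of _ "{..n}"]) auto
  then show ?thesis by (simp add: finite_fibres_def)
qed

lemma block_gf_eq:
  "(1 - fps_X ^ 2) * block_gf = fps_const (monom 1 1) * fps_X ^ 3
     + (fps_const (monom 1 1) ^ 2 - fps_const (monom 1 1)) * fps_X ^ 5"
proof -
  let ?T = "weight_gf (\<lambda>k :: nat. 2 * k + 1) (\<lambda>k. if k = 1 then 1 else 2)"
  let ?x = "fps_const (monom 1 1) :: int poly fps"
  have sq: "fps_const (monom 1 2) = ?x ^ 2"
    by (simp add: power2_eq_square mult_monom numeral_2_eq_2)
  have one: "{1 :: nat..} = {1} \<union> {2..}" and two: "{2 :: nat..} = {2} \<union> {3..}" by auto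
  have 1: "?T {1..} = ?x * fps_X ^ 3 + ?T {2..}"
    unfolding one by (subst weight_gf_Un[OF finite_fibres_block]) (auto simp: weight_gf_singleton)
  have 2: "?T {2..} = ?x ^ 2 * fps_X ^ 5 + ?T {3..}"
    unfolding two by (subst weight_gf_Un[OF finite_fibres_block]) (auto simp: weight_gf_singleton sq)
  \<comment> \<open>From \<open>k = 2\<close> on the weight is constant, so the shift by one
    multiplies the series by t^2; this sums the geometric tail.\<close>
  have "{3 :: nat..} = Suc ` {2..}"
    by (auto simp: image_iff Bex_def) presburger
  then have "?T {3..} = weight_gf (\<lambda>k. (2 * k + 1) + 2) (\<lambda>k. if k = 1 then 1 else 2) {2..}"
    by (simp only:) (subst weight_gf_image, auto intro!: weight_gf_cong)
  then have 3: "?T {3..} = fps_X ^ 2 * ?T {2..}"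
    by (simp only: weight_gf_length_add)
  have "(1 - fps_X ^ 2) * ?T {2..} = ?x ^ 2 * fps_X ^ 5"
    using 2 unfolding 3 by (simp add: algebra_simps)
  then have "(1 - fps_X ^ 2) * block_gf = (1 - fps_X ^ 2) * (?x * fps_X ^ 3) + ?x ^ 2 * fps_X ^ 5"
    unfolding block_gf_def 1 by (simp only: distrib_left)
  also have "\<dots> = ?x * fps_X ^ 3 + (?x ^ 2 - ?x) * fps_X ^ 5"
  proof -
    have "(1 - t ^ 2) * (y * t ^ 3) + y ^ 2 * t ^ 5 = y * t ^ 3 + (y ^ 2 - y) * t ^ 5"
      for y t :: "int poly fps" by algebra
    then show ?thesis .
  qed
  finally show ?thesis .
qed

lemma inj_block: "inj_on (\<lambda>(k, r). block k r) ({1..} \<times> S)"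
proof (rule inj_onI, clarify)
  fix k r k' r' assume "block k r = block k' r'"
  then have "k = k' \<and> replicate (Suc k) False @ r = replicate (Suc k') False @ r'"
    unfolding block_def by (intro leading_ones_unique) auto
  then show "k = k' \<and> r = r'" by auto
qed

lemma word_gf_zero_words:
  "word_gf (zero_words S) = fps_X *
    (word_gf S + (fps_const (monom 1 1) - 1) * word_gf {s \<in> S. run_constrained (True # s)})"
proof -
  have "word_gf (zero_words S) = weight_gf (\<lambda>s. length s + 1)
      (\<lambda>s. flip_count s + (if run_constrained (True # s) then 1 else 0)) S"
    by (subst weight_gf_image) (auto intro!: weight_gf_cong simp: flip_count_False)
  then show ?thesis
    by (simp only: weight_gf_length_add weight_gf_bonus finite_fibres_length power_one_right)
qed

lemma word_gf_block_words:
  assumes "S \<subseteq> run_words"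
  shows "word_gf (block_words S) = block_gf *
    (word_gf S + (fps_const (monom 1 1) - 1) * word_gf {s \<in> S. leading_zeros s \<ge> 2})"
proof -
  have "word_gf (block_words S) = weight_gf (\<lambda>(k, r). (2 * k + 1) + length r)
      (\<lambda>(k, r). (if k = 1 then 1 else 2) + (flip_count r + (if leading_zeros r \<ge> 2 then 1 else 0)))
      ({1..} \<times> S)"
    using assms
    by (subst weight_gf_image[OF inj_block], intro weight_gf_cong)
      (auto simp: flip_count_block run_words_def subset_iff)
  also have "\<dots> = block_gf * weight_gf length
      (\<lambda>r. flip_count r + (if leading_zeros r \<ge> 2 then 1 else 0)) S"
    unfolding block_gf_def by (rule weight_gf_Times[OF finite_fibres_block finite_fibres_length])
  finally show ?thesis by (simp add: weight_gf_bonus)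
qed


section \<open>Classification of run-constrained words by their first factors\<close>

lemma zero_words_run_words: "zero_words run_words = {s \<in> run_words. leading_zeros s \<ge> 1}"
proof (intro equalityI subsetI)
  fix s assume "s \<in> {s \<in> run_words. leading_zeros s \<ge> 1}"
  then show "s \<in> zero_words run_words"
    by (cases s; cases "hd s") (auto simp: run_words_def)
qed (auto simp: run_words_def)

lemma zero_zero_words_run_words:
  "zero_words (zero_words run_words) = {s \<in> run_words. leading_zeros s \<ge> 2}"
proof (intro equalityI subsetI)
  fix s assume "s \<in> {s \<in> run_words. leading_zeros s \<ge> 2}"
  then show "s \<in> zero_words (zero_words run_words)"
    unfolding zero_words_run_words
    by (cases s; cases "hd s") (auto simp: run_words_def)
qed (auto simp: run_words_def)

lemma zero_words_disjoint_block_words: "zero_words S \<inter> block_words T = {}"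
proof -
  have False if "s \<in> zero_words S" "s \<in> block_words T" for s
  proof -
    from that(1) obtain a where a: "s = False # a" by auto
    from that(2) obtain k r where "k \<ge> 1" "s = block k r" by auto
    with a show False by (cases k) (auto simp: block_def)
  qed
  then show ?thesis by blast
qed

lemma run_words_decomp:
  "run_words = {[]} \<union> (zero_words run_words \<union> block_words run_words)"
proof (intro equalityI subsetI)
  fix s assume "s \<in> run_words"
  then have "run_constrained s" by (simp add: run_words_def)
  then show "s \<in> {[]} \<union> (zero_words run_words \<union> block_words run_words)"
    by (cases rule: run_constrained_cases) (auto simp: run_words_def)
qed (auto simp: run_words_def run_constrained_block_iff)

text \<open>A 1 can precede a word only if one zero beyond the first factor is available: after a
  first factor 0 or a block, the rest must start with 0. The empty word fails, as a lone 1 is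
  invalid.\<close>

lemma run_words_extendable:
  "{s \<in> run_words. run_constrained (True # s)}
    = zero_words (zero_words run_words) \<union> block_words (zero_words run_words)"
proof (intro equalityI subsetI)
  fix s assume s: "s \<in> {s \<in> run_words. run_constrained (True # s)}"
  then have "run_constrained s" by (simp add: run_words_def)
  then show "s \<in> zero_words (zero_words run_words) \<union> block_words (zero_words run_words)"
  proof (cases rule: run_constrained_cases)
    case 1
    then show ?thesis using s run_constrained_ones_append[of 1 "[]"] by simp
  next
    case (2 s')
    then have "s' \<in> zero_words run_words"
      using s run_constrained_True_False[of s']
      unfolding zero_words_run_words by (simp add: run_words_def)
    then show ?thesis using 2 by blast
  next
    case (3 k r)
    then have "r \<in> zero_words run_words"
      using s run_constrained_True_block[of r k]
      unfolding zero_words_run_words by (simp add: run_words_def)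
    then show ?thesis using 3 by auto
  qed
next
  fix s assume "s \<in> zero_words (zero_words run_words) \<union> block_words (zero_words run_words)"
  then show "s \<in> {s \<in> run_words. run_constrained (True # s)}"
    by (auto simp: run_words_def run_constrained_block_iff run_constrained_True_False
        run_constrained_True_block)
qed

lemma flip_count_Nil [simp]: "flip_count [] = 0"
  by (simp add: flip_count_def)

text \<open>The unknowns are the series of all words and of those starting with \<open>0\<close>, a
  block, \<open>00\<close>, or a block followed by \<open>0\<close>. Every bonus set is a union of
  these classes, so the system closes.\<close>

lemma word_gf_system:
  fixes x :: "int poly fps"
  defines "x \<equiv> fps_const (monom 1 1)"
  defines "R \<equiv> run_words"
  shows "word_gf R = 1 + word_gf (zero_words R) + word_gf (block_words R)"
    and "word_gf (block_words R) = block_gf * (word_gf R + (x - 1) * word_gf (zero_words (zero_words R)))"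
    and "word_gf (block_words (zero_words R))
      = block_gf * (word_gf (zero_words R) + (x - 1) * word_gf (zero_words (zero_words R)))"
    and "word_gf (zero_words R) = fps_X * (word_gf R + (x - 1) *
      (word_gf (zero_words (zero_words R)) + word_gf (block_words (zero_words R))))"
    and "word_gf (zero_words (zero_words R))
      = fps_X * (word_gf (zero_words R) + (x - 1) * word_gf (zero_words (zero_words R)))"
proof -
  have nil: "{[]} \<inter> (zero_words R \<union> block_words R) = {}"
    by (auto simp: block_def)
  have "word_gf R = word_gf ({[]} \<union> (zero_words R \<union> block_words R))"
    using run_words_decomp by (simp add: R_def)
  also have "\<dots> = word_gf {[]} + (word_gf (zero_words R) + word_gf (block_words R))"
    by (simp only: weight_gf_Un[OF finite_fibres_length nil]
        weight_gf_Un[OF finite_fibres_length zero_words_disjoint_block_words])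
  finally show "word_gf R = 1 + word_gf (zero_words R) + word_gf (block_words R)"
    by (simp add: weight_gf_singleton algebra_simps)
  show "word_gf (block_words R) = block_gf * (word_gf R + (x - 1) * word_gf (zero_words (zero_words R)))"
    using word_gf_block_words[of R] by (simp add: R_def x_def zero_zero_words_run_words)
  have "{s \<in> zero_words R. leading_zeros s \<ge> 2} = zero_words (zero_words R)"
    unfolding R_def zero_zero_words_run_words by (auto simp: zero_words_run_words)
  moreover have "zero_words R \<subseteq> run_words" by (auto simp: R_def run_words_def)
  ultimately show "word_gf (block_words (zero_words R))
      = block_gf * (word_gf (zero_words R) + (x - 1) * word_gf (zero_words (zero_words R)))"
    using word_gf_block_words[of "zero_words R"] by (simp add: x_def)
  show "word_gf (zero_words R) = fps_X * (word_gf R + (x - 1) *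
      (word_gf (zero_words (zero_words R)) + word_gf (block_words (zero_words R))))"
    unfolding x_def R_def
    by (subst word_gf_zero_words, subst run_words_extendable)
      (simp only: weight_gf_Un[OF finite_fibres_length zero_words_disjoint_block_words])
  \<comment> \<open>Words starting with \<open>0\<close> that admit a preceding 1 are exactly those
    starting with \<open>00\<close>, so no new class arises.\<close>
  have "{s \<in> R. run_constrained (True # False # s)} = zero_words R"
    unfolding R_def zero_words_run_words by (auto simp: run_words_def run_constrained_True_False)
  moreover have "{s \<in> zero_words R. run_constrained (True # s)}
      = zero_words {s \<in> R. run_constrained (True # False # s)}" by auto
  ultimately show "word_gf (zero_words (zero_words R))
      = fps_X * (word_gf (zero_words R) + (x - 1) * word_gf (zero_words (zero_words R)))"
    using word_gf_zero_words[of "zero_words R"] by (simp add: x_def)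
qed

section \<open>Solution of the linear system\<close>

lemma solve_word_gf_system:
  fixes G G0 GB G00 B0 K k x t :: "'a :: idom"
  assumes G: "G = 1 + G0 + GB"
    and GB: "GB = K * (G + (x - 1) * G00)"
    and B0: "B0 = K * (G0 + (x - 1) * G00)"
    and G0: "G0 = t * (G + (x - 1) * (G00 + B0))"
    and G00: "G00 = t * (G0 + (x - 1) * G00)"
    and K: "(1 - t ^ 2) * K = k"
    and t: "t \<noteq> 0"
  shows "((1 - t ^ 2) ^ 2 * (1 - x * t) - (1 - t ^ 2) * k + t * (x - 1) * k ^ 2) * G
    = (1 - t ^ 2) * ((1 - t ^ 2) * (1 - t * (x - 1) - t ^ 2 * (x - 1)) - t * (x - 1) * k)"
proof -
  \<comment> \<open>\<open>G00\<close>, \<open>B0\<close> and \<open>G0\<close> are all multiples of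
    \<open>U\<close>, which leaves two linear equations in \<open>G\<close> and
    \<open>U\<close>.\<close>
  define U where "U = G0 + (x - 1) * G00"
  have z: "G00 = t * U" using G00 by (simp add: U_def)
  have "G0 = U - (x - 1) * G00" by (simp add: U_def)
  then have g0: "G0 = U - (x - 1) * t * U" by (simp only: z mult.assoc)
  have b: "B0 = K * U" using B0 by (simp add: U_def)
  have tG: "t * G = U * (1 - t * (x - 1) - t ^ 2 * (x - 1) - t * (x - 1) * K)"
    using G0 unfolding z b g0 by (simp add: algebra_simps power2_eq_square)
  have "G = 1 + (U - (x - 1) * t * U) + K * (G + (x - 1) * (t * U))"
    using G unfolding GB z g0 .
  then have G': "(1 - K) * G = 1 + (U - (x - 1) * t * U) + K * (x - 1) * t * U"
    by (simp add: algebra_simps)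
  define W where "W = 1 - t * (x - 1) - t ^ 2 * (x - 1) - t * (x - 1) * K"
  define E where "E = 1 - x * t - K + t * (x - 1) * K ^ 2"
  \<comment> \<open>Both sides equal \<open>t * (1 - K) * G\<close>, which eliminates
    \<open>G\<close>.\<close>
  have "(1 - K) * (U * W) = t * (1 + (U - (x - 1) * t * U) + K * (x - 1) * t * U)"
    unfolding W_def tG[symmetric] G'[symmetric] by (simp only: mult_ac)
  then have UE: "U * E = t"
    unfolding W_def E_def by (simp add: algebra_simps power2_eq_square)
  have "t * (E * G) = E * (t * G)" by (simp only: mult_ac)
  also have "\<dots> = (U * E) * W" unfolding tG W_def by (simp only: mult_ac)
  finally have EG: "E * G = W" using t unfolding UE by simp
  \<comment> \<open>\<open>E\<close> is quadratic in \<open>K\<close>, so the factor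
    \<open>(1 - t ^ 2) ^ 2\<close> turns every \<open>K\<close> into the polynomial
    \<open>k\<close>.\<close>
  have "(1 - t ^ 2) ^ 2 * (1 - x * t) - (1 - t ^ 2) * k + t * (x - 1) * k ^ 2 = (1 - t ^ 2) ^ 2 * E"
    unfolding K[symmetric] E_def by algebra
  moreover have "(1 - t ^ 2) * ((1 - t ^ 2) * (1 - t * (x - 1) - t ^ 2 * (x - 1)) - t * (x - 1) * k)
      = (1 - t ^ 2) ^ 2 * W"
    unfolding K[symmetric] W_def by algebra
  ultimately show ?thesis by (simp add: EG mult.assoc)
qed

section \<open>Passage from words to the degree enumerators\<close>

text \<open>Appending \<open>00\<close> maps the vertices bijectively onto the run-constrained words
  of length \<open>n + 2\<close>, and turns degrees into flip counts.\<close>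

lemma word_gf_nth_verts: "word_gf run_words $ (n + 2) = fib_run_deg_enum n"
proof -
  have "{s. s \<in> run_words \<and> length s = n + 2} = (\<lambda>w. w @ [False, False]) ` fib_run_verts n"
  proof (intro equalityI subsetI)
    fix s assume s: "s \<in> {s. s \<in> run_words \<and> length s = n + 2}"
    then obtain u where "s = u @ [False, False]"
      using run_constrained_suffix[of s] by (auto simp: run_words_def)
    then show "s \<in> (\<lambda>w. w @ [False, False]) ` fib_run_verts n"
      using s by (auto simp: fib_run_verts_def run_words_def)
  qed (auto simp: fib_run_verts_def run_words_def)
  moreover have "inj_on (\<lambda>w. w @ [False, False]) (fib_run_verts n)"
    by (auto simp: inj_on_def)
  ultimately show ?thesis
    by (simp add: weight_gf_nth sum.reindex fib_run_deg_enum_def fib_run_deg_eq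
        del: add_2_eq_Suc')
qed

lemma run_words_short:
  "{s. s \<in> run_words \<and> length s = 0} = {[]}"
  "{s. s \<in> run_words \<and> length s = 1} = {[False]}"
  "{s. s \<in> run_words \<and> length s = 2} = {[False, False]}"
proof -
  have not1: "\<not> run_constrained [True]"
    using run_constrained_ones_append[of 1 "[]"] by simp
  show "{s. s \<in> run_words \<and> length s = 0} = {[]}" by (auto simp: run_words_def)
  show "{s. s \<in> run_words \<and> length s = 1} = {[False]}"
  proof (intro equalityI subsetI)
    fix s assume s: "s \<in> {s. s \<in> run_words \<and> length s = 1}"
    then obtain b where b: "s = [b]" by (cases s) auto
    then show "s \<in> {[False]}" using s not1 by (cases b) (auto simp: run_words_def)
  qed (auto simp: run_words_def)
  show "{s. s \<in> run_words \<and> length s = 2} = {[False, False]}"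
    using run_constrained_suffix by (fastforce simp: run_words_def)
qed

text \<open>The single words of lengths 0, 1 and 2 have no valid flip and contribute 1, t and t^2.
  The inner \<open>+ 1\<close> accounts for length 2, that is \<open>n = 0\<close>, which
  \<open>fib_run_deg_gf\<close> omits.\<close>

lemma word_gf_run_words:
  "word_gf run_words = 1 + fps_X + fps_X ^ 2 * (fib_run_deg_gf + 1)"
proof (rule fps_ext)
  fix n :: nat
  have not_ext: "\<not> run_constrained [True]" "\<not> run_constrained [True, False]"
    using run_constrained_ones_append[of 1 "[]"] run_constrained_True_False[of "[]"] by simp_all
  then have small: "word_gf run_words $ 0 = 1" "word_gf run_words $ 1 = 1"
      "word_gf run_words $ 2 = 1"
    by (simp_all only: weight_gf_nth run_words_short)
      (simp_all add: flip_count_False monom_0 one_pCons)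
  consider "n = 0" | "n = 1" | "n = 2" | m where "n = m + 2" "m \<ge> 1"
  proof (cases "n \<ge> 3")
    case True
    then show ?thesis using that(4)[of "n - 2"] by simp
  qed (use that in linarith)
  then show "word_gf run_words $ n = (1 + fps_X + fps_X ^ 2 * (fib_run_deg_gf + 1)) $ n"
  proof cases
    case 4
    then show ?thesis using word_gf_nth_verts[of m]
      by (simp add: fps_X_power_mult_nth fib_run_deg_gf_def del: add_2_eq_Suc')
  qed (use small in \<open>simp_all add: fps_X_power_mult_nth fib_run_deg_gf_def\<close>)
qed

theorem theorem6p1:
  fixes x t N D :: "int poly fps"
  defines "x \<equiv> fps_const (monom 1 1)"
    and "t \<equiv> fps_X"
  defines "N \<equiv> x * t * (2 - (x - 2) * t + (x - 3) * t^2 - (x - 2)^2 * t^3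
      - x * (x - 1) * t^4 - 2 * (x - 1) * t^5
      - (x - 1) * (2 * x^2 - x + 1) * t^6 - 2 * x * (x - 1)^2 * t^7
      - x * (x - 1)^2 * (x + 1) * t^8
      - x * (x - 1)^3 * t^9 - x * (x - 1)^3 * t^10)"
    and "D \<equiv> 1 - x * t - 2 * t^2 + x * t^3 + t^4 - x * (x - 1) * t^5
      + x * (x - 1) * (x + 1) * t^7 + 2 * x^2 * (x - 1)^2 * t^9 + x^2 * (x - 1)^3 * t^11"
  shows "D * fps_right_inverse D 1 = 1 \<and> fib_run_deg_gf = N * fps_right_inverse D 1"
proof -
  define k where "k = x * t ^ 3 + (x ^ 2 - x) * t ^ 5"
  have t: "t \<noteq> 0" by (simp add: t_def)
  have K: "(1 - t ^ 2) * block_gf = k"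
    unfolding k_def x_def t_def by (rule block_gf_eq)
  have "((1 - t ^ 2) ^ 2 * (1 - x * t) - (1 - t ^ 2) * k + t * (x - 1) * k ^ 2) * word_gf run_words
    = (1 - t ^ 2) * ((1 - t ^ 2) * (1 - t * (x - 1) - t ^ 2 * (x - 1)) - t * (x - 1) * k)"
    using word_gf_system K t unfolding x_def t_def by (rule solve_word_gf_system)
  moreover have "(1 - t ^ 2) ^ 2 * (1 - x * t) - (1 - t ^ 2) * k + t * (x - 1) * k ^ 2 = D"
    unfolding D_def k_def by algebra
  \<comment> \<open>The summand \<open>D * (1 + t + t ^ 2)\<close> is the share of the words of
    length at most 2; what remains is the numerator shifted by t^2.\<close>
  moreover have "(1 - t ^ 2) * ((1 - t ^ 2) * (1 - t * (x - 1) - t ^ 2 * (x - 1)) - t * (x - 1) * k)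
      = D * (1 + t + t ^ 2) + t ^ 2 * N"
    unfolding D_def N_def k_def by algebra
  ultimately have "D * (1 + t + t ^ 2 * (fib_run_deg_gf + 1)) = D * (1 + t + t ^ 2) + t ^ 2 * N"
    by (simp add: word_gf_run_words t_def)
  then have "t ^ 2 * (D * fib_run_deg_gf) = t ^ 2 * N" by (simp add: algebra_simps)
  then have DF: "D * fib_run_deg_gf = N" using t by simp
  \<comment> \<open>The coefficients lie in a ring that is not a field; constant term 1 is what
    makes \<open>fps_right_inverse D 1\<close> a genuine inverse.\<close>
  have "D $ 0 = 1" by (simp add: D_def t_def)
  then have inv: "D * fps_right_inverse D 1 = 1" by (intro fps_right_inverse) simp
  have "fib_run_deg_gf = (D * fps_right_inverse D 1) * fib_run_deg_gf" by (simp add: inv)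
  also have "\<dots> = N * fps_right_inverse D 1" using DF by (simp add: mult_ac)
  finally show ?thesis using inv by simp
qed

end
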